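(* Let $G=(V,E)$ be a graph on $n$ vertices with maximum degree $\Delta$. Let $\mathcal B$ be the family of sets $B\subseteq V$ such that the induced subgraph $G[B]$ is bipartite, let $\max\mathcal B$ be the family of inclusion-maximal members of $\mathcal B$, and let $\uparrow\max\mathcal B=\{T\subseteq V : \text{there exists } S\in\max\mathcal B \text{ with } S\subseteq T\}$. Then \[ |\uparrow\max\mathcal B| \le (2^{\Delta+1}-\Delta-1)^{n/(\Delta+1)}. \]
   Context: $G[B]$ denotes the subgraph of $G$ induced by the vertex set $B$. *)

theory Defs
  imports Complex_Main "Graph_Theory.Graph_Theory"
begin

text \<open>
  Finite simple undirected graphs are rendered by the locale predicate \<^const>\<open>graph\<close>: an undirected
  edge is a pair of opposite arcs, so \<^const>\<open>out_degree\<close> counts the neighbours of a vertex.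
\<close>

text \<open>Inserting \<open>0\<close> only affects the graph without vertices, whose maximum degree becomes \<open>0\<close>.\<close>

definition max_degree :: "('a, 'b) pre_digraph \<Rightarrow> nat" where
  "max_degree G = Max (insert 0 (out_degree G ` verts G))"

definition bipartite :: "('a, 'b) pre_digraph \<Rightarrow> bool" where
  "bipartite G \<longleftrightarrow>
     (\<exists>U W. verts G = U \<union> W \<and> U \<inter> W = {} \<and>
       (\<forall>e\<in>arcs G. tail G e \<in> U \<and> head G e \<in> W \<or> tail G e \<in> W \<and> head G e \<in> U))"

definition bipartite_sets :: "('a, 'b) pre_digraph \<Rightarrow> 'a set set" where
  "bipartite_sets G = {B. B \<subseteq> verts G \<and> bipartite (G \<restriction> B)}"

definition maximal_members :: "'a set set \<Rightarrow> 'a set set" where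
  "maximal_members F = {S \<in> F. \<forall>T\<in>F. S \<subseteq> T \<longrightarrow> T = S}"

definition up_closure :: "'a set \<Rightarrow> 'a set set \<Rightarrow> 'a set set" where
  "up_closure V F = {T. T \<subseteq> V \<and> (\<exists>S\<in>F. S \<subseteq> T)}"

end

theory Submission
  imports Defs "HOL-Analysis.Convex"
begin

text \<open>
  If \<open>T\<close> contains a maximal bipartite set \<open>S\<close> and \<open>v\<close> is a vertex, then \<open>T\<close> cannot meet the closed
  neighbourhood \<open>N[v]\<close> in the empty set or in a single neighbour of \<open>v\<close>: otherwise \<open>v \<notin> S\<close> has at
  most one neighbour in \<open>S\<close>, and \<open>S \<union> {v}\<close> is still bipartite. Hence at most
  \<open>2^(d+1) - (d+1)\<close> traces on \<open>N[v]\<close> occur, where \<open>d = deg v\<close>. Shearer's inequality bounds the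
  number of sets \<open>T\<close> by a weighted product of these trace counts. Closed neighbourhoods get weight
  \<open>1/(\<Delta>+1)\<close>; the singleton \<open>{v}\<close> gets weight \<open>(\<Delta>-d)/(\<Delta>+1)\<close>, which makes every vertex
  covered with total weight one. Vertex \<open>v\<close> then contributes the \<open>(\<Delta>+1)\<close>-st root of
  \<open>(2^(d+1) - (d+1)) * 2^(\<Delta>-d)\<close>, at most \<open>2^(\<Delta>+1) - (\<Delta>+1)\<close>.
\<close>

section \<open>Shearer's inequality\<close>

text \<open>Weighted AM-GM, from convexity of \<open>exp\<close> at the points
  \<open>ln (r i)\<close>. The weights may sum to more than 1; since \<open>r i \<le> 1\<close>,
  normalising them only enlarges the product.\<close>

lemma prod_powr_le_weighted_mean:
  fixes w r :: "'i \<Rightarrow> real"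
  assumes "finite S" and w: "\<And>i. i \<in> S \<Longrightarrow> 0 \<le> w i"
    and W: "1 \<le> sum w S" and r: "\<And>i. i \<in> S \<Longrightarrow> 0 < r i \<and> r i \<le> 1"
  shows "(\<Prod>i\<in>S. r i powr w i) \<le> (\<Sum>i\<in>S. w i / sum w S * r i)"
proof -
  have ne: "S \<noteq> {}" using W by auto
  have "(\<Prod>i\<in>S. r i powr w i) = exp (\<Sum>i\<in>S. w i * ln (r i))"
    unfolding exp_sum[OF \<open>finite S\<close>] using r by (intro prod.cong) (force simp: powr_def)+
  also have "\<dots> \<le> exp (\<Sum>i\<in>S. (w i / sum w S) *\<^sub>R ln (r i))"
  proof -
    have "w i * ln (r i) \<le> (w i / sum w S) *\<^sub>R ln (r i)" if "i \<in> S" for i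
    proof -
      have "w i / sum w S \<le> w i"
        using w[OF that] W by (simp add: divide_le_eq mult_le_cancel_left1)
      moreover have "ln (r i) \<le> 0" using r[OF that] by simp
      ultimately show ?thesis using mult_right_mono_neg by fastforce
    qed
    then show ?thesis by (simp only: exp_le_cancel_iff) (rule sum_mono)
  qed
  also have "\<dots> \<le> (\<Sum>i\<in>S. w i / sum w S * exp (ln (r i)))"
    using W w by (intro convex_on_sum[OF \<open>finite S\<close> ne exp_convex])
      (auto simp flip: sum_divide_distrib)
  also have "\<dots> = (\<Sum>i\<in>S. w i / sum w S * r i)"
    using r by (intro sum.cong) auto
  finally show ?thesis .
qed

text \<open>Dividing by the right-hand side leaves products of the ratios
  \<open>a i / (a i + b i)\<close> and \<open>b i / (a i + b i)\<close>. AM-GM bounds them by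
  weighted means that add up to 1.\<close>

lemma prod_powr_superadditive:
  fixes w a b :: "'i \<Rightarrow> real"
  assumes "finite S" and w: "\<And>i. i \<in> S \<Longrightarrow> 0 \<le> w i" and W: "1 \<le> sum w S"
    and a: "\<And>i. i \<in> S \<Longrightarrow> 0 < a i" and b: "\<And>i. i \<in> S \<Longrightarrow> 0 < b i"
  shows "(\<Prod>i\<in>S. a i powr w i) + (\<Prod>i\<in>S. b i powr w i) \<le> (\<Prod>i\<in>S. (a i + b i) powr w i)"
proof -
  let ?P = "\<Prod>i\<in>S. (a i + b i) powr w i"
  have part: "(\<Prod>i\<in>S. c i powr w i) = (\<Prod>i\<in>S. (c i / (a i + b i)) powr w i) * ?P"
    if "\<And>i. i \<in> S \<Longrightarrow> 0 < c i" for c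
  proof -
    have "c i powr w i = (c i / (a i + b i)) powr w i * (a i + b i) powr w i" if "i \<in> S" for i
      using a[OF that] b[OF that] \<open>\<And>i. i \<in> S \<Longrightarrow> 0 < c i\<close>[OF that]
      by (simp flip: powr_mult)
    then show ?thesis by (simp flip: prod.distrib)
  qed
  have "(\<Prod>i\<in>S. (a i / (a i + b i)) powr w i) \<le> (\<Sum>i\<in>S. w i / sum w S * (a i / (a i + b i)))"
    using a b by (intro prod_powr_le_weighted_mean assms)
       (auto simp: add_pos_pos less_imp_le)
  moreover have "(\<Prod>i\<in>S. (b i / (a i + b i)) powr w i) \<le> (\<Sum>i\<in>S. w i / sum w S * (b i / (a i + b i)))"
    using a b by (intro prod_powr_le_weighted_mean assms)
       (auto simp: add_pos_pos less_imp_le)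
  moreover have "(\<Sum>i\<in>S. w i / sum w S * (a i / (a i + b i)))
      + (\<Sum>i\<in>S. w i / sum w S * (b i / (a i + b i))) = 1"
  proof -
    have "w i / sum w S * (a i / (a i + b i)) + w i / sum w S * (b i / (a i + b i)) = w i / sum w S"
      if "i \<in> S" for i
    proof -
      have "a i / (a i + b i) + b i / (a i + b i) = 1"
        using a[OF that] b[OF that] by (simp flip: add_divide_distrib)
      then show ?thesis by (metis distrib_left mult.right_neutral)
    qed
    then show ?thesis using W by (simp flip: sum.distrib sum_divide_distrib)
  qed
  ultimately have "(\<Prod>i\<in>S. (a i / (a i + b i)) powr w i) + (\<Prod>i\<in>S. (b i / (a i + b i)) powr w i) \<le> 1"
    by linarith
  then have "((\<Prod>i\<in>S. (a i / (a i + b i)) powr w i) + (\<Prod>i\<in>S. (b i / (a i + b i)) powr w i)) * ?P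
      \<le> 1 * ?P"
    by (rule mult_right_mono) (simp add: prod_nonneg)
  then show ?thesis
    using part[of a] part[of b] a b by (simp add: distrib_right)
qed

text \<open>Induction on the ground set, splitting \<open>F\<close> by a point \<open>x\<close>. On
  sets \<open>A i\<close> containing \<open>x\<close> the trace counts of the two halves add up, and
  superadditivity applies because these sets have total weight at least 1. On the other sets
  monotonicity suffices.\<close>

lemma shearer_inequality:
  fixes A :: "'i \<Rightarrow> 'a set" and w :: "'i \<Rightarrow> real"
  assumes "finite V" "finite I" and w: "\<And>i. i \<in> I \<Longrightarrow> 0 \<le> w i"
    and "F \<subseteq> Pow V" and "\<And>x. x \<in> V \<Longrightarrow> 1 \<le> sum w {i \<in> I. x \<in> A i}"
  shows "real (card F) \<le> (\<Prod>i\<in>I. real (card ((\<lambda>T. T \<inter> A i) ` F)) powr w i)"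
  using assms(1,4,5)
proof (induction V arbitrary: F rule: finite_induct)
  case empty
  \<comment> \<open>For \<open>F = {{}}\<close> every trace family is a singleton, so every factor
    is 1.\<close>
  then have "F = {} \<or> F = {{}}" by auto
  then show ?case by (auto simp: prod_nonneg)
next
  case (insert x V)
  define pr where "pr F i = (\<lambda>T. T \<inter> A i) ` F" for F i
  define F0 where "F0 = {T \<in> F. x \<notin> T}"
  \<comment> \<open>Deleting \<open>x\<close> turns this half into a family on \<open>V\<close>, as
    the induction hypothesis requires; no set is lost, since \<open>x\<close> can be put
    back.\<close>
  define F1 where "F1 = (\<lambda>T. T - {x}) ` {T \<in> F. x \<in> T}"
  have finF: "finite F"
    using insert.prems(1) insert.hyps(1) by (meson finite.insertI finite_Pow_iff finite_subset)
  have fin0: "finite F0" and fin1: "finite F1" using finF by (auto simp: F0_def F1_def)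
  have fin_pr: "finite (pr F i)" for i using finF by (simp add: pr_def)
  have F_eq: "F = F0 \<union> insert x ` F1"
    by (auto simp: F0_def F1_def image_image insert_absorb image_iff)
  have x0: "x \<notin> T" if "T \<in> F0" for T using that by (simp add: F0_def)
  have x1: "x \<notin> T" if "T \<in> F1" for T using that by (auto simp: F1_def)
  have card_F: "card F = card F0 + card F1"
  proof -
    have "card F = card F0 + card (insert x ` F1)"
      unfolding F_eq using fin0 fin1 x0 by (intro card_Un_disjoint) auto
    moreover have "inj_on (insert x) F1"
      using x1 by (intro inj_onI) (metis insert_ident)
    ultimately show ?thesis by (simp add: card_image)
  qed
  have pr_in: "card (pr F i) = card (pr F0 i) + card (pr F1 i)" if "x \<in> A i" for i
  proof -
    have "pr F i = pr F0 i \<union> insert x ` pr F1 i"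
      unfolding F_eq pr_def image_Un image_image using that by simp
    also have "card \<dots> = card (pr F0 i) + card (insert x ` pr F1 i)"
      using fin0 fin1 x0 by (intro card_Un_disjoint) (auto simp: pr_def)
    also have "card (insert x ` pr F1 i) = card (pr F1 i)"
    proof (rule card_image, rule inj_onI)
      fix S T assume "S \<in> pr F1 i" "T \<in> pr F1 i" "insert x S = insert x T"
      moreover from this have "x \<notin> S" "x \<notin> T" using x1 by (auto simp: pr_def)
      ultimately show "S = T" by (metis insert_ident)
    qed
    finally show ?thesis .
  qed
  have pr_notin: "pr F i = pr F0 i \<union> pr F1 i" if "x \<notin> A i" for i
    unfolding F_eq pr_def image_Un image_image using that by simp
  have le0: "card (pr F0 i) \<le> card (pr F i)" for i
    by (rule card_mono[OF fin_pr]) (auto simp: pr_def F0_def)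
  have le1: "card (pr F1 i) \<le> card (pr F i)" for i
    using pr_in[of i] pr_notin[of i] card_mono[OF fin_pr, of "pr F1 i" i]
    by (cases "x \<in> A i") auto
  have IH0: "real (card F0) \<le> (\<Prod>i\<in>I. real (card (pr F0 i)) powr w i)"
    unfolding pr_def using insert.prems by (intro insert.IH) (auto simp: F0_def)
  have IH1: "real (card F1) \<le> (\<Prod>i\<in>I. real (card (pr F1 i)) powr w i)"
    unfolding pr_def using insert.prems by (intro insert.IH) (auto simp: F1_def)
  have "real (card F) \<le> (\<Prod>i\<in>I. real (card (pr F i)) powr w i)"
  \<comment> \<open>Superadditivity needs positive trace counts. If one half is empty, the other has
    as many members as \<open>F\<close>, and monotonicity is enough.\<close>
  proof (cases "F0 = {} \<or> F1 = {}")
    case True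
    have "real (card F0) \<le> (\<Prod>i\<in>I. real (card (pr F i)) powr w i)"
      using le0 w by (intro order.trans[OF IH0] prod_mono conjI powr_mono2) auto
    moreover have "real (card F1) \<le> (\<Prod>i\<in>I. real (card (pr F i)) powr w i)"
      using le1 w by (intro order.trans[OF IH1] prod_mono conjI powr_mono2) auto
    ultimately show ?thesis using True card_F by auto
  next
    case False
    have pos: "0 < card (pr F0 i)" "0 < card (pr F1 i)" for i
      using False fin0 fin1 by (auto simp: pr_def card_gt_0_iff)
    let ?K = "{i \<in> I. x \<in> A i}" and ?L = "{i \<in> I. x \<notin> A i}"
    let ?p = "\<lambda>F J. \<Prod>i\<in>J. real (card (pr F i)) powr w i"
    have split: "?p F I = ?p F ?L * ?p F ?K" for F
    proof -
      have "I = ?L \<union> ?K" by auto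
      then have "?p F I = ?p F (?L \<union> ?K)" by simp
      also have "\<dots> = ?p F ?L * ?p F ?K"
        using \<open>finite I\<close> by (intro prod.union_disjoint) auto
      finally show ?thesis .
    qed
    have K: "?p F0 ?K + ?p F1 ?K \<le> ?p F ?K"
    proof -
      have "?p F0 ?K + ?p F1 ?K
          \<le> (\<Prod>i\<in>?K. (real (card (pr F0 i)) + real (card (pr F1 i))) powr w i)"
        using \<open>finite I\<close> w insert.prems(2) pos by (intro prod_powr_superadditive) auto
      also have "\<dots> = ?p F ?K" by (intro prod.cong) (auto simp: pr_in)
      finally show ?thesis .
    qed
    have nonneg: "0 \<le> ?p F J" for F J by (simp add: prod_nonneg)
    have L0: "?p F0 ?L \<le> ?p F ?L"
      using le0 w by (intro prod_mono conjI powr_mono2) auto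
    have L1: "?p F1 ?L \<le> ?p F ?L"
      using le1 w by (intro prod_mono conjI powr_mono2) auto
    have "real (card F) \<le> ?p F0 ?L * ?p F0 ?K + ?p F1 ?L * ?p F1 ?K"
      using IH0 IH1 split card_F by simp
    also have "\<dots> \<le> ?p F ?L * ?p F0 ?K + ?p F ?L * ?p F1 ?K"
      using L0 L1 nonneg by (intro add_mono mult_right_mono) auto
    also have "\<dots> \<le> ?p F ?L * ?p F ?K"
      using mult_left_mono[OF K nonneg] by (simp add: distrib_left)
    finally show ?thesis by (simp add: split)
  qed
  then show ?case by (simp add: pr_def)
qed

section \<open>Traces on closed neighbourhoods\<close>

definition out_nbrs :: "('a, 'b) pre_digraph \<Rightarrow> 'a \<Rightarrow> 'a set" where
  "out_nbrs G v = head G ` out_arcs G v"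

context graph
begin

lemma arcs_reverse:
  assumes "e \<in> arcs G"
  obtains e' where "e' \<in> arcs G" "tail G e' = head G e" "head G e' = tail G e"
  using assms sym_arcs unfolding symmetric_conv by metis

lemma out_nbrs_subset: "out_nbrs G v \<subseteq> verts G"
  by (auto simp: out_nbrs_def)

lemma finite_out_nbrs: "finite (out_nbrs G v)"
  using out_nbrs_subset finite_verts by (rule finite_subset)

lemma notin_out_nbrs: "v \<notin> out_nbrs G v"
  by (auto simp: out_nbrs_def dest: no_loops)

lemma card_out_nbrs: "card (out_nbrs G v) = out_degree G v"
  unfolding out_nbrs_def out_degree_def
  by (rule card_image) (auto intro!: inj_onI no_multi_arcs simp: arc_to_ends_def)

lemma out_nbrs_sym: "u \<in> out_nbrs G v \<longleftrightarrow> v \<in> out_nbrs G u"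
proof -
  have "u \<in> out_nbrs G v" if vu: "v \<in> out_nbrs G u" for u v
  proof -
    obtain e where "e \<in> arcs G" "tail G e = u" "head G e = v"
      using vu by (auto simp: out_nbrs_def)
    then show ?thesis
      using arcs_reverse[of e] unfolding out_nbrs_def by (metis imageI in_out_arcs_conv)
  qed
  then show ?thesis by blast
qed

text \<open>Colour \<open>v\<close> opposite to \<open>u\<close>, its only possible neighbour in
  \<open>S\<close>. Leaving \<open>u\<close> arbitrary also covers a \<open>v\<close> without
  neighbours in \<open>S\<close>.\<close>

lemma bipartite_insert:
  assumes bip: "bipartite (G \<restriction> S)" and v: "v \<notin> S" and S: "out_nbrs G v \<inter> S \<subseteq> {u}"
  shows "bipartite (G \<restriction> insert v S)"
proof -
  obtain U W where UW: "S = U \<union> W" "U \<inter> W = {}"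
    and arcs: "\<And>e. e \<in> arcs G \<Longrightarrow> tail G e \<in> S \<Longrightarrow> head G e \<in> S \<Longrightarrow>
      tail G e \<in> U \<and> head G e \<in> W \<or> tail G e \<in> W \<and> head G e \<in> U"
    using bip unfolding bipartite_def by auto
  \<comment> \<open>The colour classes are interchangeable, so let \<open>W\<close> be one that
    avoids \<open>u\<close>; \<open>v\<close> joins \<open>W\<close>.\<close>
  have *: "bipartite (G \<restriction> insert v S)"
    if UW: "S = U \<union> W" "U \<inter> W = {}" and u: "u \<notin> W"
      and arcs: "\<And>e. e \<in> arcs G \<Longrightarrow> tail G e \<in> S \<Longrightarrow> head G e \<in> S \<Longrightarrow>
        tail G e \<in> U \<and> head G e \<in> W \<or> tail G e \<in> W \<and> head G e \<in> U" for U W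
    unfolding bipartite_def
  proof (intro exI conjI ballI)
    show "verts (G \<restriction> insert v S) = U \<union> insert v W" using UW by auto
    show "U \<inter> insert v W = {}" using UW v by auto
  next
    fix e assume "e \<in> arcs (G \<restriction> insert v S)"
    then have e: "e \<in> arcs G" "tail G e \<in> insert v S" "head G e \<in> insert v S" by auto
    have out: "head G e \<in> U" if "tail G e = v"
    proof -
      have "head G e \<in> out_nbrs G v" using e that by (auto simp: out_nbrs_def)
      then show ?thesis using e(3) S UW u notin_out_nbrs[of v] by auto
    qed
    have inn: "tail G e \<in> U" if "head G e = v"
    proof -
      have "head G e \<in> out_nbrs G (tail G e)" using e by (auto simp: out_nbrs_def)
      then have "tail G e \<in> out_nbrs G v" using that out_nbrs_sym by simp
      then show ?thesis using e(2) S UW u notin_out_nbrs[of v] by auto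
    qed
    show "tail (G \<restriction> insert v S) e \<in> U \<and> head (G \<restriction> insert v S) e \<in> insert v W \<or>
      tail (G \<restriction> insert v S) e \<in> insert v W \<and> head (G \<restriction> insert v S) e \<in> U"
      using e arcs[OF e(1)] out inn by auto
  qed
  show ?thesis
  proof (cases "u \<in> W")
    case True
    then show ?thesis using UW arcs by (intro *[of W U]) blast+
  next
    case False
    then show ?thesis using UW arcs by (intro *[of U W]) blast+
  qed
qed

text \<open>Otherwise a maximal bipartite \<open>S\<close> inside \<open>T\<close> would miss
  \<open>v\<close> and contain at most the neighbour \<open>u\<close> of \<open>v\<close>, so adding
  \<open>v\<close> would contradict maximality.\<close>

lemma up_closure_maximal_bipartite_neighbours:
  assumes T: "T \<in> up_closure (verts G) (maximal_members (bipartite_sets G))"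
    and v: "v \<in> verts G" "v \<notin> T"
  shows "\<not> out_nbrs G v \<inter> T \<subseteq> {u}"
proof
  assume sub: "out_nbrs G v \<inter> T \<subseteq> {u}"
  obtain S where S: "S \<in> maximal_members (bipartite_sets G)" "S \<subseteq> T"
    using T by (auto simp: up_closure_def)
  have vS: "v \<notin> S" using v S(2) by auto
  have "bipartite (G \<restriction> S)" "S \<subseteq> verts G"
    using S(1) by (auto simp: maximal_members_def bipartite_sets_def)
  moreover have "out_nbrs G v \<inter> S \<subseteq> {u}" using sub S(2) by auto
  ultimately have "insert v S \<in> bipartite_sets G"
    using bipartite_insert[of S v u] vS v by (auto simp: bipartite_sets_def)
  then have "insert v S = S"
    using S(1) by (auto simp: maximal_members_def)
  then show False using vS by auto
qed

lemma card_traces_le: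
  assumes v: "v \<in> verts G"
  defines "d \<equiv> out_degree G v"
  shows "real (card ((\<lambda>T. T \<inter> insert v (out_nbrs G v)) `
      up_closure (verts G) (maximal_members (bipartite_sets G)))) \<le> 2 ^ (d + 1) - (real d + 1)"
proof -
  let ?N = "out_nbrs G v" and ?U = "up_closure (verts G) (maximal_members (bipartite_sets G))"
  \<comment> \<open>The \<open>d + 1\<close> forbidden traces; the singleton \<open>{v}\<close> is
    not among them.\<close>
  let ?X = "insert {} ((\<lambda>u. {u}) ` ?N)"
  have "T \<inter> insert v ?N \<noteq> {}" if "T \<in> ?U" for T
    using up_closure_maximal_bipartite_neighbours[OF that v, of v] by auto
  moreover have "T \<inter> insert v ?N \<noteq> {u}" if "T \<in> ?U" "u \<in> ?N" for T u
  proof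
    assume eq: "T \<inter> insert v ?N = {u}"
    then have "v \<notin> T" using that(2) notin_out_nbrs by (metis IntI insertI1 singletonD)
    then show False using up_closure_maximal_bipartite_neighbours[OF that(1) v] eq by blast
  qed
  ultimately have "(\<lambda>T. T \<inter> insert v ?N) ` ?U \<subseteq> Pow (insert v ?N) - ?X" by auto
  then have "card ((\<lambda>T. T \<inter> insert v ?N) ` ?U) \<le> card (Pow (insert v ?N) - ?X)"
    using finite_out_nbrs by (intro card_mono) auto
  also have "\<dots> = card (Pow (insert v ?N)) - card ?X"
    using finite_out_nbrs by (intro card_Diff_subset) auto
  also have "card (Pow (insert v ?N)) = 2 ^ (d + 1)"
    using finite_out_nbrs notin_out_nbrs card_out_nbrs by (simp add: card_Pow d_def)
  also have "card ?X = d + 1"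
  proof -
    have "card ?X = Suc (card ((\<lambda>u. {u}) ` ?N))"
      using finite_out_nbrs by (intro card_insert_disjoint) auto
    then show ?thesis using card_out_nbrs by (simp add: card_image d_def)
  qed
  finally have "card ((\<lambda>T. T \<inter> insert v ?N) ` ?U) \<le> 2 ^ (d + 1) - (d + 1)" .
  \<comment> \<open>Subtraction on naturals truncates; this bound makes it agree with real
    subtraction.\<close>
  moreover have "d + 1 \<le> 2 ^ (d + 1)" using less_exp[of "d + 1"] by linarith
  ultimately have "real (card ((\<lambda>T. T \<inter> insert v ?N) ` ?U)) \<le> real (2 ^ (d + 1)) - real (d + 1)"
    by (simp only: of_nat_le_iff flip: of_nat_diff)
  then show ?thesis by simp
qed

end

section \<open>Numerical estimate and the final bound\<close>

lemma pow_diff_times_pow_le: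
  fixes d \<Delta> :: nat
  assumes "d \<le> \<Delta>"
  shows "(2 ^ (d + 1) - (real d + 1)) * 2 ^ (\<Delta> - d) \<le> 2 ^ (\<Delta> + 1) - real \<Delta> - 1"
proof -
  \<comment> \<open>After expansion the claim reads \<open>d + k + 1 \<le> (d + 1) * 2 ^ k\<close>,
    which follows from \<open>k + 1 \<le> 2 ^ k\<close>.\<close>
  obtain k where k: "\<Delta> = d + k" using assms le_Suc_ex by blast
  have "real (k + 1) \<le> real (2 ^ k)"
    unfolding of_nat_le_iff using less_exp[of k] by linarith
  then have "real k + 1 \<le> 2 ^ k" by simp
  then have "(real d + 1) * (real k + 1) \<le> (real d + 1) * 2 ^ k"
    by (intro mult_left_mono) auto
  moreover have "real d + real k + 1 \<le> (real d + 1) * (real k + 1)"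
    by (simp add: algebra_simps)
  ultimately have "real d + real k + 1 \<le> (real d + 1) * 2 ^ k" by linarith
  then show ?thesis by (simp add: k power_add algebra_simps)
qed

theorem theorem3p8:
  fixes G :: "('a, 'b) pre_digraph" and n \<Delta> :: nat
  assumes "graph G"
    and "card (verts G) = n"
    and "max_degree G = \<Delta>"
  shows "real (card (up_closure (verts G) (maximal_members (bipartite_sets G))))
         \<le> (2 ^ (\<Delta> + 1) - real \<Delta> - 1) powr (real n / real (\<Delta> + 1))"
proof -
  interpret graph G by fact
  let ?U = "up_closure (verts G) (maximal_members (bipartite_sets G))"
  let ?C = "2 ^ (\<Delta> + 1) - real \<Delta> - 1"
  define V where "V = verts G"
  define d where "d v = out_degree G v" for v
  \<comment> \<open>The sum type gives each vertex two indices, kept apart even when both sets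
    coincide, as at an isolated vertex.\<close>
  define A where "A = case_sum (\<lambda>v. insert v (out_nbrs G v)) (\<lambda>v. {v})"
  define w :: "'a + 'a \<Rightarrow> real" where "w = case_sum (\<lambda>v. 1 / real (\<Delta> + 1)) 
    (\<lambda>v. real (\<Delta> - d v) / real (\<Delta> + 1))"
  have finV: "finite V" by (simp add: V_def)
  have d_le: "d v \<le> \<Delta>" if "v \<in> V" for v
    using that finV unfolding assms(3)[symmetric] max_degree_def d_def V_def
    by (intro Max_ge) auto
  have w_nonneg: "0 \<le> w i" for i by (auto simp: w_def split: sum.split)
  have cover: "1 \<le> sum w {i \<in> V <+> V. x \<in> A i}" if x: "x \<in> V" for x
  proof -
    \<comment> \<open>By symmetry of adjacency, \<open>x\<close> lies in the closed neighbourhood of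
      \<open>v\<close> exactly when \<open>v\<close> lies in that of \<open>x\<close>: this gives
      \<open>d x + 1\<close> sets, besides the singleton of \<open>x\<close>.\<close>
    have "{i \<in> V <+> V. x \<in> A i} = insert x (out_nbrs G x) <+> {x}"
      using x out_nbrs_sym out_nbrs_subset by (auto simp: A_def V_def)
    then have "sum w {i \<in> V <+> V. x \<in> A i} =
        real (d x + 1) / real (\<Delta> + 1) + real (\<Delta> - d x) / real (\<Delta> + 1)"
      using finite_out_nbrs notin_out_nbrs card_out_nbrs
      by (simp add: sum.Plus w_def d_def add_divide_distrib)
    also have "\<dots> = 1"
      using d_le[OF x] by (simp add: of_nat_diff flip: add_divide_distrib)
    finally show ?thesis by simp
  qed
  define c where "c i = real (card ((\<lambda>T. T \<inter> A i) ` ?U))" for i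
  have "real (card ?U) \<le> (\<Prod>i\<in>V <+> V. c i powr w i)"
    unfolding c_def using finV w_nonneg cover
    by (intro shearer_inequality[of V]) (auto simp: up_closure_def V_def)
  also have "\<dots> = (\<Prod>v\<in>V. c (Inl v) powr w (Inl v) * c (Inr v) powr w (Inr v))"
    using finV by (simp add: prod.Plus prod.distrib)
  also have "\<dots> \<le> (\<Prod>v\<in>V. ?C powr (1 / real (\<Delta> + 1)))"
  proof (intro prod_mono conjI)
    fix v assume v: "v \<in> V"
    let ?t = "2 ^ (d v + 1) - (real (d v) + 1)"
    have cl: "c (Inl v) \<le> ?t"
      unfolding c_def A_def d_def using card_traces_le[of v] v by (simp add: V_def)
    \<comment> \<open>\<open>?t\<close> bounds a cardinality; its sign is needed to merge the two
      powers into one root.\<close>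
    then have t: "0 \<le> ?t" by (rule order.trans[rotated]) (simp add: c_def)
    have cr: "c (Inr v) \<le> 2"
    proof -
      have "card ((\<lambda>T. T \<inter> {v}) ` ?U) \<le> card (Pow {v})" by (intro card_mono) auto
      then show ?thesis by (simp add: c_def A_def card_Pow)
    qed
    have "c (Inl v) powr w (Inl v) * c (Inr v) powr w (Inr v) \<le> ?t powr w (Inl v) * 2 powr w (Inr v)"
      using cl cr w_nonneg by (intro mult_mono powr_mono2) (auto simp: c_def)
    also have "\<dots> = (?t * 2 ^ (\<Delta> - d v)) powr (1 / real (\<Delta> + 1))"
    proof -
      have "(2::real) powr w (Inr v) = (2 ^ (\<Delta> - d v)) powr (1 / real (\<Delta> + 1))"
        by (simp add: w_def powr_powr flip: powr_realpow)
      then show ?thesis using t by (simp add: w_def powr_mult)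
    qed
    also have "\<dots> \<le> ?C powr (1 / real (\<Delta> + 1))"
      using pow_diff_times_pow_le[OF d_le[OF v]] t by (intro powr_mono2) auto
    finally show "c (Inl v) powr w (Inl v) * c (Inr v) powr w (Inr v) \<le> ?C powr (1 / real (\<Delta> + 1))" .
  qed auto
  also have "\<dots> = ?C powr (real n / real (\<Delta> + 1))"
  proof -
    \<comment> \<open>A nonzero base matters for \<open>n = 0\<close>: the empty product is 1,
      whereas \<open>0 powr 0\<close> is 0.\<close>
    have "real (\<Delta> + 1) < real (2 ^ (\<Delta> + 1))"
      unfolding of_nat_less_iff by (rule less_exp)
    then have "0 < ?C" by simp
    then show ?thesis
      using assms(2) by (simp add: V_def powr_power)
  qed
  finally show ?thesis .
qed

end
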